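(* Let $p>480$ be a prime and let $N>0$ be an integer with $\gcd(N,p)=1$ which is $(480,p)$-good. Then the Fermat surface $x^N+y^N+z^N=1$ has no solutions $x,y,z\in\mathbb{F}_p(t)$ satisfying $x,y,z\notin\mathbb{F}_p(t^p)$ and $x/y,\ x/z,\ y/z\notin\mathbb{F}_p(t^p)$.
   Context: An integer $N>0$ is called $(X,p)$-good if the congruence $ap^s+b\equiv0\pmod N$ has no solutions in integers $s\ge0$, $0<a,b\le X$. Here $t$ is transcendental over $\mathbb{F}_p$. *)

theory Defs
  imports
    "HOL-Computational_Algebra.Polynomial"
    "HOL-Computational_Algebra.Fraction_Field"
    "HOL-Number_Theory.Cong"
    "Berlekamp_Zassenhaus.Finite_Field"
begin

definition good :: "nat \<Rightarrow> nat \<Rightarrow> nat \<Rightarrow> bool" where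
  "good X p N \<longleftrightarrow> N > 0 \<and>
     \<not> (\<exists>s a b :: nat. 0 < a \<and> a \<le> X \<and> 0 < b \<and> b \<le> X \<and> [a * p ^ s + b = 0] (mod N))"

(* F_p(t): the prime field Z/pZ is 'p mod_ring with CARD('p) = p, and the transcendental t is
   the polynomial variable, so the rational function field is the fraction field of
   'p mod_ring poly. *)
type_synonym 'p ratfun = "'p mod_ring poly fract"

(* K(t^n) inside K(t): the quotients f(t^n) / g(t^n) with g nonzero.  For n > 0 the polynomial
   g(t^n) is then nonzero as well; only this case is used. *)
definition ratfun_power_subfield :: "nat \<Rightarrow> 'a::field poly fract set" where
  "ratfun_power_subfield n =
     {Fraction_Field.Fract (pcompose f (monom 1 n)) (pcompose g (monom 1 n)) | f g. g \<noteq> 0}"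

end

theory Submission
  imports "HOL-Algebra.Algebraic_Closure_Type" Defs
begin

text \<open>
  Clear denominators and pass to the algebraic closure: a solution becomes \<open>F\<^sub>0\<^sup>N + \<dots> + F\<^sub>3\<^sup>N = 0\<close> with
  polynomials \<open>F\<^sub>i\<close> without common root, and the hypotheses on \<open>x, y, z\<close> and their quotients say that
  all Wronskians \<open>w\<^sub>i\<^sub>j = W(F\<^sub>i, F\<^sub>j)\<close> are nonzero. Goodness with \<open>s = 0\<close> gives \<open>N > 960\<close>, so a degree count shows
  that the 3-by-3 Wronskians of the \<open>F\<^sub>i\<^sup>N\<close> vanish. Hence for fixed \<open>l\<close> the three polynomials \<open>W(F\<^sub>l\<^sup>N, F\<^sub>j\<^sup>N)\<close>
  have sum zero and ratios with zero derivative: up to a common factor they are \<open>q\<close>-th powers \<open>a\<^sup>q, b\<^sup>q, c\<^sup>q\<close>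
  with \<open>q = p\<^sup>s\<close>, \<open>s > 0\<close> and \<open>a + b + c = 0\<close>; taking \<open>s\<close> maximal, the Mason-Stothers inequality shows that
  \<open>a b c\<close> has at least \<open>max deg\<close> distinct roots.

  Let \<open>e\<^sub>i\<^sub>j(v) = ord\<^sub>v w\<^sub>i\<^sub>j - ord\<^sub>v F\<^sub>i - ord\<^sub>v F\<^sub>j \<ge> -1\<close>, whose sum over all \<open>v\<close> is negative; so the points with
  some \<open>e\<^sub>i\<^sub>j(v) \<ge> 480\<close> are few compared with the roots of \<open>F\<^sub>0 F\<^sub>1 F\<^sub>2 F\<^sub>3\<close>. At any other root only one \<open>F\<^sub>k\<close>
  vanishes, to order \<open>i\<close> say, and comparing orders gives \<open>N i = q m + r\<close> with \<open>0 \<le> r \<le> 480\<close>, where \<open>m\<close> is the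
  multiplicity of \<open>v\<close> in \<open>a b c\<close>; so goodness (or \<open>N | m\<close> when \<open>r = 0\<close>) forces \<open>m > 480\<close>. Thus almost all roots of
  \<open>F\<^sub>0 F\<^sub>1 F\<^sub>2 F\<^sub>3\<close> are roots of \<open>a b c\<close> of high multiplicity, which Mason-Stothers does not allow.
\<close>

subsection \<open>Wronskians and orders of vanishing\<close>

definition wronskian :: "'a::field poly \<Rightarrow> 'a poly \<Rightarrow> 'a poly" where
  "wronskian f g = f * pderiv g - pderiv f * g"

lemma degree_pderiv_le: "degree (pderiv f) \<le> degree f - 1"
  by (intro degree_le) (auto simp: coeff_pderiv intro!: coeff_eq_0)

lemma wronskian_swap: "wronskian g f = - wronskian f g"
  by (simp add: wronskian_def mult.commute)

lemma wronskian_mult_left: "wronskian (h * f) (h * g) = h ^ 2 * wronskian f g"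
  by (simp add: wronskian_def pderiv_mult algebra_simps power2_eq_square)

lemma wronskian_power:
  assumes "n > 0"
  shows "wronskian (f ^ n) (g ^ n) = of_nat n * ((f * g) ^ (n - 1) * wronskian f g)"
proof -
  obtain m where n: "n = Suc m"
    using assms gr0_implies_Suc by blast
  show ?thesis
    unfolding n wronskian_def pderiv_power_Suc of_nat_poly
    by (simp add: algebra_simps power_mult_distrib)
qed

lemma power_dvd_pderiv:
  fixes f g :: "'a::field poly"
  assumes "g ^ n dvd f"
  shows "g ^ (n - 1) dvd pderiv f"
proof (cases n)
  case (Suc m)
  obtain h where "f = g ^ n * h"
    using assms by (elim dvdE)
  then have "pderiv f = g ^ m * (g * pderiv h + smult (of_nat (Suc m)) (pderiv g * h))"
    unfolding Suc by (simp only: pderiv_mult pderiv_power_Suc) (simp add: algebra_simps)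
  then show ?thesis
    using Suc by simp
qed simp

lemma power_dvd_wronskian:
  fixes f g h :: "'a::field poly"
  assumes "h ^ m dvd f" "h ^ n dvd g"
  shows "h ^ (m + n - 1) dvd wronskian f g"
proof -
  have "h ^ (m + (n - 1)) dvd f * pderiv g"
    unfolding power_add by (intro mult_dvd_mono assms power_dvd_pderiv)
  moreover have "h ^ ((m - 1) + n) dvd pderiv f * g"
    unfolding power_add by (intro mult_dvd_mono assms power_dvd_pderiv)
  moreover have "m + n - 1 \<le> m + (n - 1)" "m + n - 1 \<le> (m - 1) + n"
    by auto
  ultimately show ?thesis
    unfolding wronskian_def by (meson dvd_diff dvd_trans le_imp_power_dvd)
qed

lemma order_wronskian_ge:
  assumes "wronskian f g \<noteq> 0"
  shows "order v f + order v g \<le> order v (wronskian f g) + 1"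
  using power_dvd_wronskian[OF order_1[of v f] order_1[of v g]] assms
  by (simp add: order_divides)

text \<open>The factor \<open>order v f\<close> that differentiation brings out is nonzero in the
  field, so \<open>pderiv f * g\<close> loses exactly one order, while \<open>f * pderiv g\<close>
  loses none.\<close>

lemma order_wronskian_eq:
  fixes f g :: "'a::field poly"
  assumes "f \<noteq> 0" "of_nat (order v f) \<noteq> (0::'a)" "poly g v \<noteq> 0"
  shows "order v (wronskian f g) + 1 = order v f"
proof -
  define n where "n = order v f"
  obtain q where q: "f = [:-v, 1:] ^ n * q" "\<not> [:-v, 1:] dvd q"
    using order_decomp[OF assms(1), of v] n_def by blast
  have "n \<noteq> 0"
    using assms(2) n_def by (metis of_nat_0)
  then obtain m where m: "n = Suc m"
    using not0_implies_Suc by blast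
  define h where "h = [:-v, 1:] * (q * pderiv g - pderiv q * g) - smult (of_nat n) (q * g)"
  have "wronskian f g = [:-v, 1:] ^ m * h"
    unfolding h_def wronskian_def q(1) m lemma_order_pderiv1
    by (simp add: algebra_simps)
  moreover have "poly h v \<noteq> 0"
    using assms(2,3) q(2) by (simp add: h_def n_def poly_eq_0_iff_dvd)
  moreover from this have "[:-v, 1:] ^ m * h \<noteq> 0"
    by auto
  ultimately have "order v (wronskian f g) = m"
    by (simp add: order_mult order_power_n_n order_0I del: mult_pCons_left)
  then show ?thesis
    using m n_def by simp
qed

text \<open>Differentiation kills constants and lowers every other degree. The strictness later
  makes the total of \<open>eps\<close> negative.\<close>

lemma degree_wronskian_less:
  assumes "wronskian f g \<noteq> 0"
  shows "degree (wronskian f g) < degree f + degree g"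
proof -
  have "f * pderiv g = 0 \<or> degree (f * pderiv g) < degree f + degree g" for f g :: "'a poly"
  proof (cases "degree g = 0")
    case True
    then show ?thesis
      by (metis degree_eq_zeroE mult_zero_right pderiv_singleton)
  next
    case False
    then show ?thesis
      using degree_mult_le[of f "pderiv g"] degree_pderiv_le[of g] by linarith
  qed
  from this[of f g] this[of g f] have
    "f * pderiv g = 0 \<or> degree (f * pderiv g) < degree f + degree g"
    "pderiv f * g = 0 \<or> degree (pderiv f * g) < degree f + degree g"
    by (simp_all add: mult.commute add.commute)
  then show ?thesis
    using assms unfolding wronskian_def
    by (metis degree_diff_less degree_minus diff_0 diff_zero)
qed

section \<open>Degrees, orders and vanishing derivatives over an algebraically closed field\<close>

lemma degree_eq_sum_order:
  fixes f :: "'a::alg_closed_field poly"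
  assumes "f \<noteq> 0" "finite P" "\<And>v. poly f v = 0 \<Longrightarrow> v \<in> P"
  shows "degree f = (\<Sum>v\<in>P. order v f)"
proof -
  obtain A where A: "size A = degree f" "f = smult (lead_coeff f) (\<Prod>x\<in>#A. [:-x, 1:])"
    using alg_closed_imp_factorization[OF assms(1)] by blast
  have "proots f = proots (\<Prod>x\<in>#A. [:-x, 1:])"
    by (subst A(2)) (use assms(1) in simp)
  also have "\<dots> = A"
  proof (induction A)
    case (add x A)
    have "(\<Prod>x\<in>#A. [:-x, 1:]) \<noteq> 0"
      by (auto simp: prod_mset_zero_iff)
    then have "proots ([:-x, 1:] * (\<Prod>x\<in>#A. [:-x, 1:])) = {#x#} + A"
      by (subst proots_mult) (use add in auto)
    then show ?case
      by simp
  qed simp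
  finally have "degree f = size (proots f)"
    using A(1) by simp
  also have "\<dots> = (\<Sum>v\<in>{v. poly f v = 0}. order v f)"
    using assms(1) by (simp add: size_multiset_overloaded_eq)
  \<comment> \<open>\<open>P\<close> may be any finite set containing the roots, so that several
    polynomials can share one index set.\<close>
  also have "\<dots> = (\<Sum>v\<in>P. order v f)"
    using assms by (intro sum.mono_neutral_left) (auto simp: order_0I)
  finally show ?thesis .
qed

lemma degree_le_if_order_le:
  fixes f g :: "'a::alg_closed_field poly"
  assumes "f \<noteq> 0" "g \<noteq> 0" "\<And>v. order v f \<le> order v g"
  shows "degree f \<le> degree g"
proof -
  let ?P = "{v. poly f v = 0} \<union> {v. poly g v = 0}"
  have "finite ?P"
    using assms poly_roots_finite by auto
  then have "degree f = (\<Sum>v\<in>?P. order v f)" "degree g = (\<Sum>v\<in>?P. order v g)"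
    using assms by (auto intro: degree_eq_sum_order)
  then show ?thesis
    using assms(3) by (simp add: sum_mono)
qed

text \<open>A root is split off with its full multiplicity: the zero derivative makes this a
  multiple of the characteristic and passes to the cofactor. Constants have the required roots by
  algebraic closedness.\<close>

lemma pderiv_eq_0_imp_power_CHAR:
  fixes f :: "'a::alg_closed_field poly"
  assumes "prime CHAR('a)" "pderiv f = 0"
  shows "\<exists>g. f = g ^ CHAR('a)"
  using assms(2)
proof (induction "degree f" arbitrary: f rule: less_induct)
  case less
  have p0: "CHAR('a) > 0"
    using assms(1) prime_gt_0_nat by blast
  consider "f = 0" | "f \<noteq> 0" "degree f = 0" | "degree f > 0"
    by auto
  then show ?case
  proof cases
    case 1
    then show ?thesis
      using p0 by (intro exI[of _ 0]) simp
  next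
    case 2
    then obtain c where c: "f = [:c:]"
      by (metis degree_eq_zeroE)
    obtain d where "d ^ CHAR('a) = c"
      using nth_root_exists[OF p0] by blast
    then show ?thesis
      using c by (intro exI[of _ "[:d:]"]) (simp add: poly_const_pow)
  next
    case 3
    then obtain v where v: "poly f v = 0"
      using alg_closed_imp_poly_has_root by blast
    have f0: "f \<noteq> 0"
      using 3 by auto
    define n where "n = order v f"
    have "n > 0"
      using v f0 order_root n_def by blast
    then obtain m where m: "n = Suc m"
      using gr0_implies_Suc by blast
    obtain q where q: "f = [:-v, 1:] ^ n * q" "\<not> [:-v, 1:] dvd q"
      using order_decomp[OF f0, of v] n_def by blast
    have "pderiv f = [:-v, 1:] ^ m * ([:-v, 1:] * pderiv q + smult (of_nat n) q)"
      unfolding q(1) m lemma_order_pderiv1 by (simp add: algebra_simps)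
    then have *: "[:-v, 1:] * pderiv q + smult (of_nat n) q = 0"
      using less.prems by (metis mult_eq_0_iff power_eq_0_iff pCons_eq_0_iff one_neq_zero)
    have "poly ([:-v, 1:] * pderiv q + smult (of_nat n) q) v = of_nat n * poly q v"
      by simp
    then have n0: "of_nat n = (0::'a)"
      using q(2) unfolding * by (simp add: poly_eq_0_iff_dvd)
    then have dq: "pderiv q = 0"
      using * by (metis add.right_neutral smult_0_left mult_eq_0_iff pCons_eq_0_iff one_neq_zero)
    have "CHAR('a) dvd n"
      using n0 by (simp add: of_nat_eq_0_iff_char_dvd)
    then obtain k where k: "n = k * CHAR('a)"
      by (metis dvd_def mult.commute)
    have "degree f = n + degree q"
      using f0 unfolding q(1) by (subst degree_mult_eq) (auto simp: degree_linear_power)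
    then obtain g where "q = g ^ CHAR('a)"
      using less.hyps[of q] dq \<open>n > 0\<close> by auto
    then have "f = ([:-v, 1:] ^ k * g) ^ CHAR('a)"
      unfolding q(1) k by (simp add: power_mult_distrib power_mult)
    then show ?thesis ..
  qed
qed

text \<open>Common linear factors are removed one at a time; the degree of the nonzero
  \<open>F 0\<close> drops each time and ends the process.\<close>

lemma divide_out_common_roots:
  fixes F :: "nat \<Rightarrow> 'a::field poly"
  assumes "0 < n" "F 0 \<noteq> 0"
  shows "\<exists>G Y. G \<noteq> 0 \<and> (\<forall>i<n. F i = G * Y i) \<and> (\<forall>v. \<exists>i<n. poly (Y i) v \<noteq> 0)"
  using assms(2)
proof (induction "degree (F 0)" arbitrary: F rule: less_induct)
  case less
  show ?case
  proof (cases "\<forall>v. \<exists>i<n. poly (F i) v \<noteq> 0")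
    case True
    then show ?thesis
      by (intro exI[of _ 1] exI[of _ F]) auto
  next
    case False
    then obtain v where "\<And>i. i < n \<Longrightarrow> poly (F i) v = 0"
      by auto
    then have "\<forall>i. \<exists>y. i < n \<longrightarrow> F i = [:-v, 1:] * y"
      by (metis dvdE poly_eq_0_iff_dvd)
    then obtain Z where Z: "\<And>i. i < n \<Longrightarrow> F i = [:-v, 1:] * Z i"
      by metis
    have Z0: "Z 0 \<noteq> 0"
      using Z[OF assms(1)] less.prems by auto
    then have "degree (F 0) = Suc (degree (Z 0))"
      unfolding Z[OF assms(1)] by (subst degree_mult_eq) auto
    then obtain G Y where GY: "G \<noteq> 0" "\<forall>i<n. Z i = G * Y i" "\<forall>v. \<exists>i<n. poly (Y i) v \<noteq> 0"
      using less.hyps[of Z] Z0 by auto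
    then have "\<forall>i<n. F i = ([:-v, 1:] * G) * Y i"
      using Z GY(2) by (metis mult.assoc)
    moreover have "[:-v, 1:] * G \<noteq> 0"
      using GY(1) by (simp del: mult_pCons_left)
    ultimately show ?thesis
      using GY(3) by blast
  qed
qed

text \<open>In \<open>a * pderiv b = pderiv a * b\<close>, a root of \<open>a\<close> is no root of
  \<open>b\<close>, so \<open>pderiv a\<close> vanishes there to at least the same order; if
  nonzero, its degree is too small for that.\<close>

lemma wronskian_eq_0_imp_pderiv_eq_0:
  fixes a b :: "'a::alg_closed_field poly"
  assumes "wronskian a b = 0" "a \<noteq> 0" "b \<noteq> 0" "\<And>v. poly a v \<noteq> 0 \<or> poly b v \<noteq> 0"
  shows "pderiv a = 0"
proof (rule ccontr)
  assume a': "pderiv a \<noteq> 0"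
  have eq: "a * pderiv b = pderiv a * b"
    using assms(1) by (simp add: wronskian_def)
  have b': "pderiv b \<noteq> 0"
    using eq a' assms(3) by auto
  have "order v a \<le> order v (pderiv a)" for v
  proof (cases "poly b v = 0")
    case True
    then show ?thesis
      using assms(4)[of v] by (simp add: order_0I)
  next
    case False
    have "order v a + order v (pderiv b) = order v (pderiv a) + order v b"
      using arg_cong[OF eq, of "order v"] assms a' b' by (simp add: order_mult)
    then show ?thesis
      using False by (simp add: order_0I)
  qed
  then have "degree a \<le> degree (pderiv a)"
    using assms a' by (intro degree_le_if_order_le) auto
  moreover have "degree a > 0"
    using a' by (metis degree_eq_zeroE neq0_conv pderiv_singleton)
  ultimately show False
    using degree_pderiv_le[of a] by linarith
qed

subsection \<open>Frobenius descent and the Mason-Stothers inequality\<close>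

lemma frobenius_step:
  fixes a b c :: "'a::alg_closed_field poly"
  assumes p: "prime CHAR('a)"
    and nz: "a \<noteq> 0" "b \<noteq> 0" and sum: "a + b + c = 0"
    and cop: "\<And>v. poly a v \<noteq> 0 \<or> poly b v \<noteq> 0"
    and wr: "wronskian a b = 0"
  shows "\<exists>a' b' c'. a = a' ^ CHAR('a) \<and> b = b' ^ CHAR('a) \<and> c = c' ^ CHAR('a) \<and> a' + b' + c' = 0"
proof -
  have da: "pderiv a = 0"
    using wronskian_eq_0_imp_pderiv_eq_0[OF wr nz] cop by blast
  have db: "pderiv b = 0"
  proof (rule wronskian_eq_0_imp_pderiv_eq_0[OF _ nz(2,1)])
    show "wronskian b a = 0"
      using wr by (subst wronskian_swap) simp
  qed (use cop in blast)
  have "c = - a - b"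
    using sum by (simp add: algebra_simps add_eq_0_iff)
  then have "pderiv c = 0"
    using da db by (simp add: pderiv_diff pderiv_minus)
  then obtain a' b' c' where abc: "a = a' ^ CHAR('a)" "b = b' ^ CHAR('a)" "c = c' ^ CHAR('a)"
    using da db pderiv_eq_0_imp_power_CHAR[OF p] by meson
  have "(a' + b' + c') ^ CHAR('a) = 0"
    using sum unfolding abc by (simp add: freshmans_dream p)
  then have "a' + b' + c' = 0"
    by simp
  then show ?thesis
    using abc by blast
qed

text \<open>Frobenius steps are repeated until the Wronskian is nonzero. Constants are a separate
  outcome: their Wronskian always vanishes and no step lowers their degree.\<close>

lemma frobenius_descent:
  fixes a b c :: "'a::alg_closed_field poly"
  assumes p: "prime CHAR('a)"
    and "a \<noteq> 0" "b \<noteq> 0" "a + b + c = 0" "\<And>v. poly a v \<noteq> 0 \<or> poly b v \<noteq> 0"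
  shows "\<exists>s a' b' c'. a = a' ^ (CHAR('a) ^ s) \<and> b = b' ^ (CHAR('a) ^ s) \<and> c = c' ^ (CHAR('a) ^ s) \<and>
           a' + b' + c' = 0 \<and> (wronskian a' b' \<noteq> 0 \<or> degree a' = 0 \<and> degree b' = 0)"
  using assms(2-)
proof (induction "degree a + degree b" arbitrary: a b c rule: less_induct)
  case less
  have p2: "CHAR('a) \<ge> 2"
    using p prime_ge_2_nat by blast
  show ?case
  proof (cases "wronskian a b \<noteq> 0 \<or> degree a = 0 \<and> degree b = 0")
    case True
    then show ?thesis
      using less.prems by (intro exI[of _ 0] exI[of _ a] exI[of _ b] exI[of _ c]) simp
  next
    case False
    obtain a' b' c' where a': "a = a' ^ CHAR('a)" "b = b' ^ CHAR('a)" "c = c' ^ CHAR('a)"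
      "a' + b' + c' = 0"
      using frobenius_step[OF p less.prems(1-3)] less.prems(4) False by blast
    have nz: "a' \<noteq> 0" "b' \<noteq> 0"
      using less.prems(1,2) a' p2 by (auto simp: power_0_left)
    have "degree a = CHAR('a) * degree a'" "degree b = CHAR('a) * degree b'"
      using nz unfolding a' by (simp_all add: degree_power_eq)
    moreover from this have "degree a' + degree b' > 0"
      using False by auto
    moreover have "2 * (degree a' + degree b') \<le> CHAR('a) * (degree a' + degree b')"
      using p2 by (rule mult_le_mono1)
    ultimately have "degree a' + degree b' < degree a + degree b"
      unfolding distrib_left by linarith
    moreover have "poly a' v \<noteq> 0 \<or> poly b' v \<noteq> 0" for v
      using less.prems(4)[of v] p2 unfolding a' by (auto simp: power_0_left)
    ultimately obtain s a'' b'' c'' where "a' = a'' ^ (CHAR('a) ^ s)" "b' = b'' ^ (CHAR('a) ^ s)"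
      "c' = c'' ^ (CHAR('a) ^ s)" "a'' + b'' + c'' = 0"
      "wronskian a'' b'' \<noteq> 0 \<or> degree a'' = 0 \<and> degree b'' = 0"
      using less.hyps[of a' b' c'] nz a'(4) by blast
    then show ?thesis
      using a' by (intro exI[of _ "Suc s"] exI[of _ a''] exI[of _ b''] exI[of _ c''])
        (auto simp: power_mult[symmetric] mult.commute)
  qed
qed

text \<open>The three pairwise Wronskians agree, and at most one of \<open>a\<close>,
  \<open>b\<close>, \<open>c\<close> vanishes at a given point. So the sum of the degrees is at most
  that of the Wronskian plus the number of roots, and the Wronskian has degree less than the sum of
  any two.\<close>

lemma mason_stothers:
  fixes a b c :: "'a::alg_closed_field poly"
  assumes nz: "a \<noteq> 0" "b \<noteq> 0" "c \<noteq> 0" and sum: "a + b + c = 0"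
    and cop: "\<And>v. poly a v \<noteq> 0 \<or> poly b v \<noteq> 0"
    and wr: "wronskian a b \<noteq> 0"
  shows "degree a < card {v. poly (a * b * c) v = 0}"
    and "degree b < card {v. poly (a * b * c) v = 0}"
    and "degree c < card {v. poly (a * b * c) v = 0}"
proof -
  let ?W = "wronskian a b"
  define R where "R = {v. poly (a * b * c) v = 0}"
  define P where "P = R \<union> {v. poly ?W v = 0}"
  have c: "c = - a - b"
    using sum by (simp add: algebra_simps add_eq_0_iff)
  have Wbc: "wronskian b c = ?W" and Wca: "wronskian c a = ?W"
    unfolding c wronskian_def by (simp_all add: pderiv_diff pderiv_minus algebra_simps)
  have finR: "finite R"
    unfolding R_def using nz by (intro poly_roots_finite) auto
  then have finP: "finite P"
    unfolding P_def using wr poly_roots_finite by blast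
  have local: "order v a + order v b + order v c \<le> order v ?W + (if v \<in> R then 1 else 0)" for v
  proof (cases "v \<in> R")
    case True
    have "poly a v + poly b v + poly c v = 0"
      using arg_cong[OF sum, of "\<lambda>f. poly f v"] by simp
    then have "poly a v \<noteq> 0 \<and> poly b v \<noteq> 0 \<or> poly b v \<noteq> 0 \<and> poly c v \<noteq> 0 \<or> poly c v \<noteq> 0 \<and> poly a v \<noteq> 0"
      using cop[of v] by auto
    then show ?thesis
      using True order_wronskian_ge[of a b v] order_wronskian_ge[of b c v]
        order_wronskian_ge[of c a v] wr unfolding Wbc Wca by (auto simp: order_0I)
  next
    case False
    then have "poly a v \<noteq> 0" "poly b v \<noteq> 0" "poly c v \<noteq> 0"
      by (auto simp: R_def)
    then show ?thesis
      using False by (simp add: order_0I)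
  qed
  have "degree a + degree b + degree c = (\<Sum>v\<in>P. order v a + order v b + order v c)"
    using nz finP by (subst (1 2 3) degree_eq_sum_order[where P = P]) (auto simp: P_def R_def sum.distrib)
  also have "\<dots> \<le> (\<Sum>v\<in>P. order v ?W + (if v \<in> R then 1 else 0))"
    by (intro sum_mono local)
  also have "\<dots> = degree ?W + card R"
  proof -
    have "(\<Sum>v\<in>P. if v \<in> R then 1 else 0) = card (P \<inter> R)"
      using finP by (simp add: sum.inter_restrict[symmetric])
    moreover have "P \<inter> R = R"
      by (auto simp: P_def)
    ultimately show ?thesis
      using wr finP by (subst degree_eq_sum_order[where P = P]) (auto simp: P_def sum.distrib)
  qed
  finally have "degree a + degree b + degree c \<le> degree ?W + card R" .
  then show "degree a < card {v. poly (a * b * c) v = 0}"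
    "degree b < card {v. poly (a * b * c) v = 0}" "degree c < card {v. poly (a * b * c) v = 0}"
    using degree_wronskian_less[of a b] degree_wronskian_less[of b c] degree_wronskian_less[of c a] wr
    unfolding Wbc Wca R_def by auto
qed

text \<open>After removal of the common factor, the descent ends either where Mason-Stothers applies
  or at constants, whose degree bound is trivial.\<close>

lemma frobenius_mason:
  fixes A B C :: "'a::alg_closed_field poly"
  assumes p: "prime CHAR('a)"
    and nz: "A \<noteq> 0" "B \<noteq> 0" "C \<noteq> 0" and sum: "A + B + C = 0" and wr: "wronskian A B = 0"
  obtains G a b c s where
    "s > 0" "G \<noteq> 0"
    "A = G * a ^ (CHAR('a) ^ s)" "B = G * b ^ (CHAR('a) ^ s)" "C = G * c ^ (CHAR('a) ^ s)"
    "a \<noteq> 0" "b \<noteq> 0" "c \<noteq> 0" "a + b + c = 0" "\<And>v. poly a v \<noteq> 0 \<or> poly b v \<noteq> 0"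
    "degree (a * b * c) \<le> 3 * card {v. poly (a * b * c) v = 0}"
proof -
  have p0: "CHAR('a) > 0"
    using p prime_gt_0_nat by blast
  define F where "F = (\<lambda>i::nat. if i = 0 then A else B)"
  obtain G Y where GY: "G \<noteq> 0" "\<forall>i<2. F i = G * Y i" "\<forall>v. \<exists>i<2. poly (Y i) v \<noteq> 0"
    using divide_out_common_roots[of 2 F] nz(1) by (auto simp: F_def)
  define a1 b1 where "a1 = Y 0" and "b1 = Y 1"
  define c1 where "c1 = - a1 - b1"
  have A: "A = G * a1" and B: "B = G * b1"
    using GY(2)[rule_format, of 0] GY(2)[rule_format, of 1] by (simp_all add: F_def a1_def b1_def)
  have "C = - A - B"
    using sum by (simp add: algebra_simps add_eq_0_iff)
  then have C: "C = G * c1"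
    unfolding A B c1_def by (simp add: algebra_simps)
  have cop1: "poly a1 v \<noteq> 0 \<or> poly b1 v \<noteq> 0" for v
    using GY(3) by (metis One_nat_def a1_def b1_def less_2_cases)
  have nz1: "a1 \<noteq> 0" "b1 \<noteq> 0" "c1 \<noteq> 0"
    using nz A B C by auto
  have "a1 + b1 + c1 = 0"
    by (simp add: c1_def)
  have "G ^ 2 * wronskian a1 b1 = 0"
    using wr unfolding A B wronskian_mult_left .
  then have "wronskian a1 b1 = 0"
    using GY(1) by simp
  then obtain a2 b2 c2 where a2: "a1 = a2 ^ CHAR('a)" "b1 = b2 ^ CHAR('a)" "c1 = c2 ^ CHAR('a)"
    "a2 + b2 + c2 = 0"
    using frobenius_step[OF p nz1(1,2) \<open>a1 + b1 + c1 = 0\<close> cop1] by blast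
  have nz2: "a2 \<noteq> 0" "b2 \<noteq> 0"
    using nz1 a2 p0 by (auto simp: power_0_left)
  have "poly a2 v \<noteq> 0 \<or> poly b2 v \<noteq> 0" for v
    using cop1[of v] p0 unfolding a2 by (auto simp: power_0_left)
  then obtain s a b c where abc: "a2 = a ^ (CHAR('a) ^ s)" "b2 = b ^ (CHAR('a) ^ s)"
    "c2 = c ^ (CHAR('a) ^ s)" "a + b + c = 0" "wronskian a b \<noteq> 0 \<or> degree a = 0 \<and> degree b = 0"
    using frobenius_descent[OF p nz2 a2(4)] by blast
  \<comment> \<open>One step is forced by \<open>wr\<close> and \<open>s\<close> more come from the
    descent, so the exponent is positive.\<close>
  define q where "q = CHAR('a) ^ Suc s"
  have q0: "q > 0"
    using p0 by (simp add: q_def)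
  have eq: "a1 = a ^ q" "b1 = b ^ q" "c1 = c ^ q"
    unfolding a2 abc q_def by (simp_all add: power_mult[symmetric] mult.commute)
  have nz': "a \<noteq> 0" "b \<noteq> 0" "c \<noteq> 0"
    using nz1 eq q0 by (auto simp: power_0_left)
  have cop: "poly a v \<noteq> 0 \<or> poly b v \<noteq> 0" for v
    using cop1[of v] q0 unfolding eq by (auto simp: power_0_left)
  have "degree (a * b * c) \<le> 3 * card {v. poly (a * b * c) v = 0}"
  proof (cases "wronskian a b = 0")
    case True
    then have "degree a = 0" "degree b = 0"
      using abc by auto
    moreover have "c = - a - b"
      using abc(4) by (simp add: algebra_simps add_eq_0_iff)
    ultimately have "degree c = 0"
      by (metis degree_diff_le degree_minus le_zero_eq)
    then show ?thesis
      using \<open>degree a = 0\<close> \<open>degree b = 0\<close> nz' by (simp add: degree_mult_eq)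
  next
    case False
    then show ?thesis
      using mason_stothers[OF nz' abc(4) cop] nz' by (simp add: degree_mult_eq)
  qed
  then show thesis
    using that[of "Suc s" G a b c] GY(1) A B C eq nz' abc(4) cop unfolding q_def by blast
qed

text \<open>With \<open>R\<close> the root set, \<open>(m + 3) * card (R - B)\<close> is at most the
  degree, hence at most \<open>3 * card (R - B) + 3 * card B\<close>; the summand 3 cancels.\<close>

lemma card_high_multiplicity_roots_le:
  fixes f :: "'a::alg_closed_field poly"
  assumes "f \<noteq> 0" "degree f \<le> 3 * card {v. poly f v = 0}" "finite B"
    and "\<And>v. v \<notin> B \<Longrightarrow> poly f v = 0 \<Longrightarrow> m + 3 \<le> order v f"
    and "\<And>v. v \<in> T \<Longrightarrow> v \<notin> B \<and> poly f v = 0"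
  shows "m * card T \<le> 3 * card B"
proof -
  define R where "R = {v. poly f v = 0}"
  have finR: "finite R"
    unfolding R_def using assms(1) by (rule poly_roots_finite)
  have "(m + 3) * card (R - B) = (\<Sum>v\<in>R - B. m + 3)"
    by simp
  also have "\<dots> \<le> (\<Sum>v\<in>R - B. order v f)"
    using assms(4) by (intro sum_mono) (auto simp: R_def)
  also have "\<dots> \<le> (\<Sum>v\<in>R. order v f)"
    using finR by (intro sum_mono2) auto
  also have "\<dots> = degree f"
    using degree_eq_sum_order[OF assms(1) finR] by (simp add: R_def)
  also have "\<dots> \<le> 3 * card R"
    using assms(2) by (simp add: R_def)
  also have "card R \<le> card (R - B) + card B"
    using finR assms(3) by (metis card_mono card_Un_le finite_Diff finite_UnI le_trans Un_Diff_cancel2 Un_upper1)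
  finally have "m * card (R - B) \<le> 3 * card B"
    by (simp add: algebra_simps)
  moreover have "card T \<le> card (R - B)"
    using assms(5) finR by (intro card_mono) (auto simp: R_def)
  ultimately show ?thesis
    by (meson le_trans mult_le_mono2)
qed

subsection \<open>Solutions over an algebraically closed field\<close>

definition wronskian3 :: "'a::field poly \<Rightarrow> 'a poly \<Rightarrow> 'a poly \<Rightarrow> 'a poly" where
  "wronskian3 f g h = f * wronskian (pderiv g) (pderiv h) - g * wronskian (pderiv f) (pderiv h)
     + h * wronskian (pderiv f) (pderiv g)"

lemma wronskian_wronskian:
  "wronskian (wronskian f g) (wronskian f h) = f * wronskian3 f g h"
  unfolding wronskian3_def wronskian_def
  by (simp add: pderiv_mult pderiv_diff algebra_simps)

lemma degree_wronskian3_le: "degree (wronskian3 f g h) \<le> degree f + degree g + degree h"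
proof -
  have deg: "degree (a * wronskian (pderiv b) (pderiv c)) \<le> degree a + degree b + degree c" for a b c :: "'a poly"
  proof -
    have "degree (pderiv b * pderiv (pderiv c)) \<le> degree b + degree c"
      using degree_mult_le[of "pderiv b" "pderiv (pderiv c)"] degree_pderiv_le[of b]
        degree_pderiv_le[of c] degree_pderiv_le[of "pderiv c"] by linarith
    moreover have "degree (pderiv (pderiv b) * pderiv c) \<le> degree b + degree c"
      using degree_mult_le[of "pderiv (pderiv b)" "pderiv c"] degree_pderiv_le[of b]
        degree_pderiv_le[of c] degree_pderiv_le[of "pderiv b"] by linarith
    ultimately have "degree (wronskian (pderiv b) (pderiv c)) \<le> degree b + degree c"
      unfolding wronskian_def by (rule degree_diff_le)
    then show ?thesis
      using degree_mult_le[of a "wronskian (pderiv b) (pderiv c)"] by linarith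
  qed
  show ?thesis
    unfolding wronskian3_def
    using deg[of f g h] deg[of g f h] deg[of h f g]
    by (intro degree_add_le degree_diff_le) linarith+
qed

text \<open>Two derivatives remove at most two factors of an \<open>n\<close>-th power, so each
  column of the determinant keeps a power \<open>n - 2\<close>.\<close>

lemma power_dvd_wronskian3:
  "(f * g * h) ^ (n - 2) dvd wronskian3 (f ^ n) (g ^ n) (h ^ n)"
proof -
  have ex: "\<exists>a b c. u ^ n = u ^ (n - 2) * a \<and> pderiv (u ^ n) = u ^ (n - 2) * b \<and>
      pderiv (pderiv (u ^ n)) = u ^ (n - 2) * c" for u :: "'a poly"
  proof -
    have "u ^ (n - 1) dvd pderiv (u ^ n)"
      by (rule power_dvd_pderiv) simp
    moreover from this have "u ^ (n - 1 - 1) dvd pderiv (pderiv (u ^ n))"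
      by (rule power_dvd_pderiv)
    moreover have "u ^ (n - 2) dvd u ^ (n - 1)" "u ^ (n - 2) dvd u ^ n"
      by (auto intro: le_imp_power_dvd)
    ultimately have "u ^ (n - 2) dvd u ^ n" "u ^ (n - 2) dvd pderiv (u ^ n)"
      "u ^ (n - 2) dvd pderiv (pderiv (u ^ n))"
      by (auto intro: dvd_trans simp: numeral_2_eq_2)
    then show ?thesis
      by (meson dvdE)
  qed
  obtain a0 a1 a2 where a: "f ^ n = f ^ (n - 2) * a0" "pderiv (f ^ n) = f ^ (n - 2) * a1"
      "pderiv (pderiv (f ^ n)) = f ^ (n - 2) * a2"
    using ex by blast
  obtain b0 b1 b2 where b: "g ^ n = g ^ (n - 2) * b0" "pderiv (g ^ n) = g ^ (n - 2) * b1"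
      "pderiv (pderiv (g ^ n)) = g ^ (n - 2) * b2"
    using ex by blast
  obtain c0 c1 c2 where c: "h ^ n = h ^ (n - 2) * c0" "pderiv (h ^ n) = h ^ (n - 2) * c1"
      "pderiv (pderiv (h ^ n)) = h ^ (n - 2) * c2"
    using ex by blast
  \<comment> \<open>The nine entries become variables, so that the factorisations replace them
    without rewriting \<open>f ^ n\<close> inside its own derivatives.\<close>
  have "wronskian3 (f ^ n) (g ^ n) (h ^ n) =
      F0 * (G1 * H2 - G2 * H1) - G0 * (F1 * H2 - F2 * H1) + H0 * (F1 * G2 - F2 * G1)"
    if "F0 = f ^ n" "F1 = pderiv (f ^ n)" "F2 = pderiv (pderiv (f ^ n))"
      "G0 = g ^ n" "G1 = pderiv (g ^ n)" "G2 = pderiv (pderiv (g ^ n))"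
      "H0 = h ^ n" "H1 = pderiv (h ^ n)" "H2 = pderiv (pderiv (h ^ n))"
    for F0 F1 F2 G0 G1 G2 H0 H1 H2
    unfolding wronskian3_def wronskian_def that ..
  from this[OF a[symmetric] b[symmetric] c[symmetric]]
  have "wronskian3 (f ^ n) (g ^ n) (h ^ n) = (f * g * h) ^ (n - 2) *
    (a0 * (b1 * c2 - b2 * c1) - b0 * (a1 * c2 - a2 * c1) + c0 * (a1 * b2 - a2 * b1))"
    by (simp add: power_mult_distrib algebra_simps)
  then show ?thesis
    by simp
qed

lemma order_power_eq:
  fixes f :: "'a::idom poly"
  assumes "f \<noteq> 0"
  shows "order v (f ^ n) = n * order v f"
  using assms by (induction n) (simp_all add: order_mult)

text \<open>All four triples share the determinant \<open>W\<close> up to sign. Some polynomial is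
  nonzero at each point, so \<open>W\<close> has degree at least \<open>(N - 2) * D\<close>;
  averaging four upper bounds gives at most three quarters of \<open>N * D\<close>. For
  \<open>N > 8\<close> this forces \<open>D = 0\<close>.\<close>

lemma wronskian3_fermat_eq_0:
  fixes f g h k :: "'a::alg_closed_field poly"
  assumes N: "N > 8" and sum: "f ^ N + g ^ N + h ^ N + k ^ N = 0"
    and nz: "f \<noteq> 0" "g \<noteq> 0" "h \<noteq> 0" "k \<noteq> 0"
    and cop: "\<And>v. poly f v \<noteq> 0 \<or> poly g v \<noteq> 0 \<or> poly h v \<noteq> 0 \<or> poly k v \<noteq> 0"
    and nonconst: "degree f > 0 \<or> degree g > 0"
  shows "wronskian3 (f ^ N) (g ^ N) (h ^ N) = 0"
proof (rule ccontr)
  define W where "W = wronskian3 (f ^ N) (g ^ N) (h ^ N)"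
  assume "wronskian3 (f ^ N) (g ^ N) (h ^ N) \<noteq> 0"
  then have W0: "W \<noteq> 0"
    by (simp add: W_def)
  have k: "k ^ N = - (f ^ N) - g ^ N - h ^ N"
    using sum by (simp add: algebra_simps add_eq_0_iff)
  have W: "wronskian3 (f ^ N) (g ^ N) (k ^ N) = - W" "wronskian3 (f ^ N) (h ^ N) (k ^ N) = W"
    "wronskian3 (g ^ N) (h ^ N) (k ^ N) = - W"
    unfolding W_def k by (simp_all add: wronskian3_def wronskian_def pderiv_diff pderiv_minus pderiv_add algebra_simps)
  have dvd: "(f * g * h) ^ (N - 2) dvd W" "(f * g * k) ^ (N - 2) dvd W"
    "(f * h * k) ^ (N - 2) dvd W" "(g * h * k) ^ (N - 2) dvd W"
    using power_dvd_wronskian3[of f g h N] power_dvd_wronskian3[of f g k N]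
      power_dvd_wronskian3[of f h k N] power_dvd_wronskian3[of g h k N]
    unfolding W W_def[symmetric] by simp_all
  have triple: "(N - 2) * (order v a + order v b + order v c) \<le> order v W"
    if "(a * b * c) ^ (N - 2) dvd W" "a \<noteq> 0" "b \<noteq> 0" "c \<noteq> 0" for a b c v
    using dvd_imp_order_le[OF W0 that(1), of v] that(2-)
    by (simp add: order_mult order_power_eq)
  have local: "order v ((f * g * h * k) ^ (N - 2)) \<le> order v W" for v
  proof -
    have "order v ((f * g * h * k) ^ (N - 2)) = (N - 2) * (order v f + order v g + order v h + order v k)"
      using nz by (simp add: order_mult order_power_eq)
    moreover have "order v f = 0 \<or> order v g = 0 \<or> order v h = 0 \<or> order v k = 0"
      using cop[of v] by (auto simp: order_0I)
    ultimately show ?thesis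
      using triple[OF dvd(1) nz(1,2,3), of v] triple[OF dvd(2) nz(1,2,4), of v]
        triple[OF dvd(3) nz(1,3,4), of v] triple[OF dvd(4) nz(2,3,4), of v] by auto
  qed
  define D where "D = degree f + degree g + degree h + degree k"
  have "degree ((f * g * h * k) ^ (N - 2)) \<le> degree W"
    using local nz W0 by (intro degree_le_if_order_le) auto
  then have le: "(N - 2) * D \<le> degree W"
    using nz by (simp add: degree_power_eq degree_mult_eq D_def ac_simps)
  have "degree W \<le> N * (degree f + degree g + degree h)"
    using degree_wronskian3_le[of "f ^ N" "g ^ N" "h ^ N"] nz
    by (simp add: degree_power_eq W_def algebra_simps)
  moreover have "degree W \<le> N * (degree f + degree g + degree k)"
    using degree_wronskian3_le[of "f ^ N" "g ^ N" "k ^ N"] nz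
    unfolding W by (simp add: degree_power_eq algebra_simps)
  moreover have "degree W \<le> N * (degree f + degree h + degree k)"
    using degree_wronskian3_le[of "f ^ N" "h ^ N" "k ^ N"] nz
    unfolding W by (simp add: degree_power_eq algebra_simps)
  moreover have "degree W \<le> N * (degree g + degree h + degree k)"
    using degree_wronskian3_le[of "g ^ N" "h ^ N" "k ^ N"] nz
    unfolding W by (simp add: degree_power_eq algebra_simps)
  ultimately have "4 * degree W \<le> 3 * (N * D)"
    by (simp add: D_def algebra_simps)
  then have "4 * ((N - 2) * D) \<le> 3 * (N * D)"
    using le by linarith
  moreover obtain n where n: "N = n + 9"
    using N le_Suc_ex[of 9 N] by (auto simp: add.commute)
  ultimately have "D = 0"
    by (simp add: algebra_simps)
  then show False
    using nonconst by (simp add: D_def)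
qed

text \<open>The exponent \<open>s = 0\<close> suffices: a number from 2 to \<open>2 * F\<close> is a
  sum of two positive integers up to \<open>F\<close>, and modulo 1 every congruence holds.\<close>

lemma good_imp_greater:
  assumes "good F p N" "F > 0"
  shows "N > 2 * F"
proof (rule ccontr)
  assume "\<not> N > 2 * F"
  have N: "N > 0"
    using assms(1) by (simp add: good_def)
  consider "N = 1" | "N \<ge> 2"
    using N by linarith
  then show False
  proof cases
    case 1
    have "[1 * p ^ 0 + 1 = 0] (mod N)"
      using 1 by (simp add: cong_def)
    then show ?thesis
      using assms unfolding good_def by (metis One_nat_def Suc_leI zero_less_one)
  next
    case 2
    define a where "a = N div 2"
    have "[a * p ^ 0 + (N - a) = 0] (mod N)"
      by (simp add: cong_def a_def)
    moreover have "0 < a" "a \<le> F" "0 < N - a" "N - a \<le> F"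
      using 2 \<open>\<not> N > 2 * F\<close> by (auto simp: a_def)
    ultimately show ?thesis
      using assms(1) unfolding good_def by blast
  qed
qed

text \<open>The fourth polynomial will come from the common denominator, scaled by an
  \<open>N\<close>-th root of -1, so that all indices play symmetric roles.\<close>

locale fermat_solution =
  fixes F :: "nat \<Rightarrow> 'a::alg_closed_field poly" and N p :: nat
  assumes CHAR: "CHAR('a) = p" and prime: "prime p" and p_gt: "p > 480"
    and coprime: "coprime N p" and good: "good 480 p N"
    and sum_eq: "(\<Sum>i<4. F i ^ N) = 0"
    and no_common_root: "\<And>v. \<exists>i<4. poly (F i) v \<noteq> 0"
    and wronskian_nz: "\<And>i j. i < 4 \<Longrightarrow> j < 4 \<Longrightarrow> i \<noteq> j \<Longrightarrow> wronskian (F i) (F j) \<noteq> 0"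
begin

lemma N_gt: "N > 960"
  using good_imp_greater[OF good] by simp

lemma nz: "i < 4 \<Longrightarrow> F i \<noteq> 0"
  using wronskian_nz[of i 0] wronskian_nz[of i 1] by (cases "i = 0") (auto simp: wronskian_def)

definition distinct4 :: "nat \<Rightarrow> nat \<Rightarrow> nat \<Rightarrow> nat \<Rightarrow> bool" where
  "distinct4 l j k m \<longleftrightarrow> {l, j, k, m} = {..<4} \<and> distinct [l, j, k, m]"

lemma distinct4D:
  assumes "distinct4 l j k m"
  shows "l < 4" "j < 4" "k < 4" "m < 4" "l \<noteq> j" "l \<noteq> k" "l \<noteq> m" "j \<noteq> k" "j \<noteq> m" "k \<noteq> m"
  using assms unfolding distinct4_def by auto

lemma distinct4_sum:
  assumes "distinct4 l j k m"
  shows "F l ^ N + F j ^ N + F k ^ N + F m ^ N = 0"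
proof -
  have "(\<Sum>i\<in>{l, j, k, m}. F i ^ N) = 0"
    using assms sum_eq unfolding distinct4_def by simp
  then show ?thesis
    using distinct4D[OF assms] by (simp add: add.assoc)
qed

lemma distinct4_no_common_root:
  assumes "distinct4 l j k m"
  shows "poly (F l) v \<noteq> 0 \<or> poly (F j) v \<noteq> 0 \<or> poly (F k) v \<noteq> 0 \<or> poly (F m) v \<noteq> 0"
proof -
  obtain i where "i < 4" "poly (F i) v \<noteq> 0"
    using no_common_root by blast
  moreover from this have "i \<in> {l, j, k, m}"
    using assms unfolding distinct4_def by simp
  ultimately show ?thesis
    by auto
qed

lemma of_nat_N_nz: "of_nat N \<noteq> (0 :: 'a poly)"
proof -
  have "\<not> p dvd N"
    using coprime prime not_prime_unit by (metis coprime_absorb_left coprime_commute)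
  then show ?thesis
    using CHAR by (simp add: of_nat_eq_0_iff_char_dvd)
qed

definition W :: "nat \<Rightarrow> nat \<Rightarrow> 'a poly" where
  "W i j = (F i * F j) ^ (N - 1) * wronskian (F i) (F j)"

text \<open>The order at \<open>v\<close> of the logarithmic derivative of \<open>F\<^sub>j / F\<^sub>i\<close>.\<close>
definition eps :: "nat \<Rightarrow> nat \<Rightarrow> 'a \<Rightarrow> int" where
  "eps i j v = int (order v (wronskian (F i) (F j))) - int (order v (F i)) - int (order v (F j))"

text \<open>The threshold is the bound in goodness: elsewhere every \<open>eps\<close> of two
  different indices lies between -1 and 479.\<close>

definition bad :: "'a set" where
  "bad = {v. \<exists>i<4. \<exists>j<4. i \<noteq> j \<and> eps i j v \<ge> 480}"

lemma eps_commute: "eps i j v = eps j i v"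
  unfolding eps_def by (subst wronskian_swap) simp

lemma eps_ge:
  assumes "i < 4" "j < 4" "i \<noteq> j"
  shows "eps i j v \<ge> -1"
  using order_wronskian_ge[OF wronskian_nz[OF assms], of v] unfolding eps_def by linarith

lemma eps_less:
  assumes "v \<notin> bad" "i < 4" "j < 4" "i \<noteq> j"
  shows "eps i j v < 480"
  using assms unfolding bad_def by force

lemma wronskian_power_eq: "wronskian (F i ^ N) (F j ^ N) = of_nat N * W i j"
  using N_gt unfolding W_def by (subst wronskian_power) simp_all

lemma W_nz: "i < 4 \<Longrightarrow> j < 4 \<Longrightarrow> i \<noteq> j \<Longrightarrow> W i j \<noteq> 0"
  using nz wronskian_nz by (simp add: W_def)

text \<open>The multiple of \<open>N\<close> is the main term; \<open>eps\<close> is an error that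
  is small away from \<open>bad\<close>.\<close>

lemma order_W:
  assumes "i < 4" "j < 4" "i \<noteq> j"
  shows "int (order v (W i j)) = int N * (int (order v (F i)) + int (order v (F j))) + eps i j v"
proof -
  have "order v (W i j) = (N - 1) * (order v (F i) + order v (F j)) + order v (wronskian (F i) (F j))"
    using nz wronskian_nz assms unfolding W_def by (simp add: order_mult order_power_eq)
  moreover obtain M where "N = Suc M"
    using N_gt by (cases N) auto
  ultimately show ?thesis
    by (simp add: eps_def algebra_simps)
qed

text \<open>Taking the Wronskian with \<open>F l ^ N\<close> is linear and kills
  \<open>F l ^ N\<close>; it is applied to the Fermat relation, and \<open>N\<close>, nonzero in the
  field, is cancelled.\<close>

lemma W_sum:
  assumes "distinct4 l j k m"
  shows "W l j + W l k + W l m = 0"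
proof -
  have *: "F m ^ N = - (F l ^ N + F j ^ N + F k ^ N)"
    unfolding eq_neg_iff_add_eq_0 using distinct4_sum[OF assms] by (simp add: add_ac)
  have "wronskian (F l ^ N) (F j ^ N) + wronskian (F l ^ N) (F k ^ N) + wronskian (F l ^ N) (F m ^ N) = 0"
    unfolding * by (simp add: wronskian_def pderiv_add pderiv_diff pderiv_minus algebra_simps)
  then have "of_nat N * (W l j + W l k + W l m) = 0"
    unfolding wronskian_power_eq by (simp add: algebra_simps)
  then show ?thesis
    using of_nat_N_nz by (simp only: mult_eq_0_iff) simp
qed

lemma wronskian_W:
  assumes "distinct4 l j k m"
  shows "wronskian (W l j) (W l k) = 0"
proof -
  note d = distinct4D[OF assms]
  have "degree (F l) > 0 \<or> degree (F j) > 0"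
    using wronskian_nz[OF d(1,2,5)] degree_wronskian_less[of "F l" "F j"] by auto
  then have "wronskian3 (F l ^ N) (F j ^ N) (F k ^ N) = 0"
    using N_gt distinct4_sum[OF assms] nz d distinct4_no_common_root[OF assms]
    by (intro wronskian3_fermat_eq_0[where k = "F m"]) auto
  then have "wronskian (of_nat N * W l j) (of_nat N * W l k) = 0"
    using wronskian_wronskian[of "F l ^ N" "F j ^ N" "F k ^ N"] unfolding wronskian_power_eq by simp
  then show ?thesis
    using of_nat_N_nz unfolding wronskian_mult_left by simp
qed

text \<open>
  If \<open>F\<^sub>l\<close> and \<open>F\<^sub>j\<close> vanish at \<open>v\<close>, then \<open>(F\<^sub>k / F\<^sub>m)\<^sup>N\<close> is constant to order \<open>N\<close>, so \<open>eps k m v \<ge> N - 1\<close>.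
\<close>
lemma not_bad_one_root:
  assumes v: "v \<notin> bad" and d: "distinct4 l j k m"
    and root: "poly (F l) v = 0"
  shows "poly (F j) v \<noteq> 0"
proof
  assume rootj: "poly (F j) v = 0"
  note d' = distinct4D[OF d]
  have units: "poly (F k) v \<noteq> 0 \<and> poly (F m) v \<noteq> 0"
  proof -
    have "poly (F l) v ^ N + poly (F j) v ^ N + poly (F k) v ^ N + poly (F m) v ^ N = 0"
      using arg_cong[OF distinct4_sum[OF d], of "\<lambda>f. poly f v"] by simp
    then have *: "poly (F k) v ^ N + poly (F m) v ^ N = 0"
      using root rootj N_gt by (simp add: power_0_left)
    have "poly (F k) v = 0 \<longleftrightarrow> poly (F m) v = 0"
    proof
      assume "poly (F k) v = 0"
      with * N_gt show "poly (F m) v = 0"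
        by (simp add: power_0_left)
    next
      assume "poly (F m) v = 0"
      with * N_gt show "poly (F k) v = 0"
        by (simp add: power_0_left)
    qed
    then show ?thesis
      using distinct4_no_common_root[OF d, of v] root rootj by blast
  qed
  have "order v (F l) \<ge> 1" "order v (F j) \<ge> 1"
    using root rootj order_gt_0_iff[OF nz, of l v] order_gt_0_iff[OF nz, of j v] d' by simp_all
  then have "int N * 1 \<le> int N * int (order v (F l))" "int N * 1 \<le> int N * int (order v (F j))"
    by (intro mult_left_mono; simp)+
  then have "N - 1 \<le> order v (W k l)" "N - 1 \<le> order v (W k j)"
    using order_W[of k l v] order_W[of k j v] eps_ge[of k l v] eps_ge[of k j v] d' units
    by (simp_all add: order_0I)
  then have "[:-v, 1:] ^ (N - 1) dvd W k l" "[:-v, 1:] ^ (N - 1) dvd W k j"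
    by (simp_all add: order_divides)
  \<comment> \<open>The relation in row \<open>k\<close> carries the high order of
    \<open>W k l\<close> and \<open>W k j\<close> over to \<open>W k m\<close>, whose order is just
    \<open>eps k m v\<close>.\<close>
  moreover have "distinct4 k m l j"
    using d unfolding distinct4_def by auto
  from W_sum[OF this] have "W k m = - (W k l + W k j)"
    unfolding eq_neg_iff_add_eq_0 by (simp add: add.assoc)
  ultimately have "[:-v, 1:] ^ (N - 1) dvd W k m"
    by simp
  then have "N - 1 \<le> order v (W k m)"
    using W_nz[of k m] d' by (simp add: order_divides)
  then have "int N - 1 \<le> eps k m v"
    using order_W[of k m v] d' units N_gt by (simp add: order_0I)
  then show False
    using eps_less[OF v, of k m] d' N_gt by simp
qed

text \<open>The three orders share the term coming from \<open>F l\<close>, so they differ by at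
  most 480. As they differ by multiples of \<open>p ^ s > 480\<close> and two of \<open>a\<close>,
  \<open>b\<close>, \<open>c\<close> vanish, so does the third.\<close>

lemma row_no_root:
  assumes v: "v \<notin> bad" and d: "distinct4 l j k m" and s: "s > 0"
    and ord: "order v (W l j) = g + p ^ s * a" "order v (W l k) = g + p ^ s * b"
      "order v (W l m) = g + p ^ s * c"
    and two: "a = 0 \<and> b = 0 \<or> b = 0 \<and> c = 0 \<or> a = 0 \<and> c = 0"
    and units: "poly (F j) v \<noteq> 0" "poly (F k) v \<noteq> 0" "poly (F m) v \<noteq> 0"
  shows "a = 0 \<and> b = 0 \<and> c = 0"
proof -
  note d' = distinct4D[OF d]
  have q: "p ^ s > 480"
    using p_gt self_le_power[of p s] s by linarith
  have zero: "x = 0" if "\<bar>int (p ^ s * x) - int (p ^ s * y)\<bar> \<le> 480" "y = 0" for x y :: nat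
  proof (rule ccontr)
    assume "x \<noteq> 0"
    then have "p ^ s * 1 \<le> p ^ s * x"
      by (intro mult_left_mono) auto
    then have "int 480 < int (p ^ s * x)"
      unfolding of_nat_less_iff using q by linarith
    moreover have "int (p ^ s * y) = 0"
      using that(2) by simp
    ultimately show False
      using that(1) unfolding of_nat_numeral by linarith
  qed
  have "int (order v (W l j)) - eps l j v = int (order v (W l k)) - eps l k v"
    "int (order v (W l m)) - eps l m v = int (order v (W l k)) - eps l k v"
    using order_W[of l j v] order_W[of l k v] order_W[of l m v] d' units by (simp_all add: order_0I)
  moreover have "-1 \<le> eps l j v" "-1 \<le> eps l k v" "-1 \<le> eps l m v"
    "eps l j v < 480" "eps l k v < 480" "eps l m v < 480"
    using eps_ge eps_less[OF v] d' by auto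
  ultimately have "\<bar>int (p ^ s * a) - int (p ^ s * b)\<bar> \<le> 480" "\<bar>int (p ^ s * c) - int (p ^ s * b)\<bar> \<le> 480"
    "\<bar>int (p ^ s * b) - int (p ^ s * a)\<bar> \<le> 480" "\<bar>int (p ^ s * a) - int (p ^ s * c)\<bar> \<le> 480"
    "\<bar>int (p ^ s * b) - int (p ^ s * c)\<bar> \<le> 480"  "\<bar>int (p ^ s * c) - int (p ^ s * a)\<bar> \<le> 480"
    unfolding ord by simp_all
  then show ?thesis
    using two zero by blast
qed

text \<open>Only \<open>F j\<close> vanishes at \<open>v\<close>, so \<open>W l k\<close> and
  \<open>W l m\<close> have orders below 480; this kills \<open>b\<close> and \<open>c\<close> and
  bounds \<open>g\<close>. The order of \<open>W l j\<close> then yields the congruence excluded by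
  goodness.\<close>

lemma row_root:
  assumes v: "v \<notin> bad" and d: "distinct4 l j k m" and s: "s > 0"
    and ord: "order v (W l j) = g + p ^ s * a" "order v (W l k) = g + p ^ s * b"
      "order v (W l m) = g + p ^ s * c"
    and two: "a = 0 \<and> b = 0 \<or> b = 0 \<and> c = 0 \<or> a = 0 \<and> c = 0"
    and root: "poly (F j) v = 0"
  shows "a \<ge> 481" "b = 0" "c = 0"
proof -
  note d' = distinct4D[OF d]
  define q where "q = p ^ s"
  note ord = ord[folded q_def]
  have "p dvd q"
    using s by (simp add: q_def)
  have q: "q > 480"
    using p_gt self_le_power[of p s] s unfolding q_def by linarith
  have "distinct4 j l k m" "distinct4 j k l m" "distinct4 j m k l"
    using d unfolding distinct4_def by auto
  then have units: "poly (F l) v \<noteq> 0" "poly (F k) v \<noteq> 0" "poly (F m) v \<noteq> 0"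
    using not_bad_one_root[OF v _ root] by blast+
  define i where "i = order v (F j)"
  have i: "i \<ge> 1"
    using root order_gt_0_iff[OF nz, of j v] d'(2) by (simp add: i_def)
  have A: "int N * int i + eps l j v = int g + int (q * a)"
    and B: "eps l k v = int g + int (q * b)" and C: "eps l m v = int g + int (q * c)"
    using order_W[of l j v] order_W[of l k v] order_W[of l m v] d' units ord
    by (simp_all add: order_0I i_def)
  have eps: "-1 \<le> eps l j v" "-1 \<le> eps l k v" "-1 \<le> eps l m v"
    "eps l j v < 480" "eps l k v < 480" "eps l m v < 480"
    using eps_ge eps_less[OF v] d' by auto
  have zero: "x = 0" if "int (q * x) < 480" for x
  proof (rule ccontr)
    assume "x \<noteq> 0"
    then have "q * 1 \<le> q * x"
      by (intro mult_left_mono) auto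
    then have "int 480 < int (q * x)"
      unfolding of_nat_less_iff using q by linarith
    then show False
      using that unfolding of_nat_numeral by linarith
  qed
  show b: "b = 0" and c: "c = 0"
    using B C eps by (auto intro!: zero)
  \<comment> \<open>\<open>N\<close> exceeds 960, while \<open>g\<close> is below 480 and
    \<open>eps l j v\<close> is at least -1, so \<open>a\<close> cannot be zero.\<close>
  have "int N * 1 \<le> int N * int i"
    using i by (intro mult_left_mono) auto
  moreover have "int g < 480"
    using B eps b by simp
  moreover have "int N > 960"
    using N_gt by simp
  ultimately have "int (q * a) > 0"
    using A eps by linarith
  then have "a > 0"
    by (cases a) simp_all
  \<comment> \<open>\<open>N i = q a + (g - e)\<close> with \<open>e = eps l j v\<close>. Goodness needs \<open>g - e > 0\<close>: if \<open>p\<close> does not divide \<open>i\<close>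
    then \<open>e = -1\<close>, and otherwise \<open>p\<close> divides the small number \<open>g - e\<close>, which is therefore zero.\<close>
  show "a \<ge> 481"
  proof (cases "p dvd i")
    case True
    have "eps l j v - int g = int (q * a) - int N * int i"
      using A by simp
    moreover have "int p dvd int (q * a)"
      using \<open>p dvd q\<close> by (simp only: of_nat_dvd_iff dvd_mult2)
    moreover have "int p dvd int N * int i"
      using True by (intro dvd_mult) (simp only: of_nat_dvd_iff)
    ultimately have "int p dvd eps l j v - int g"
      by (simp only: dvd_diff)
    moreover have "\<bar>eps l j v - int g\<bar> < int p"
      using eps B b p_gt by auto
    ultimately have "eps l j v - int g = 0"
      using dvd_imp_le_int[of "eps l j v - int g" "int p"] by linarith
    then have "int (N * i) = int (q * a)"
      using A unfolding of_nat_mult by linarith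
    then have "q * a = N * i"
      by (simp only: of_nat_eq_iff)
    then have "N dvd q * a"
      by simp
    moreover have "coprime N q"
      using coprime by (simp add: q_def)
    ultimately have "N dvd a"
      by (simp add: coprime_dvd_mult_right_iff)
    then show ?thesis
      using dvd_imp_le[OF _ \<open>a > 0\<close>, of N] N_gt by linarith
  next
    case False
    then have "of_nat (order v (F j)) \<noteq> (0::'a)"
      using CHAR by (simp add: i_def of_nat_eq_0_iff_char_dvd)
    then have "order v (wronskian (F j) (F l)) + 1 = i"
      unfolding i_def using nz[OF d'(2)] units(1) by (intro order_wronskian_eq)
    then have "int (order v (wronskian (F j) (F l))) + 1 = int i"
      by linarith
    moreover have "order v (F l) = 0"
      using units(1) by (rule order_0I)
    ultimately have "eps j l v = -1"
      unfolding eps_def i_def by linarith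
    then have "eps l j v = -1"
      by (subst eps_commute)
    then have "int (N * i) = int (q * a + (g + 1))"
      using A unfolding of_nat_mult of_nat_add by linarith
    then have "N * i = q * a + (g + 1)"
      by (simp only: of_nat_eq_iff)
    from dvdI[OF this[symmetric]] have "N dvd q * a + (g + 1)" .
    then have "[a * p ^ s + (g + 1) = 0] (mod N)"
      unfolding cong_0_iff q_def mult.commute[of a] .
    moreover have "g + 1 \<le> 480"
      using \<open>int g < 480\<close> by simp
    ultimately have "\<not> a \<le> 480"
      using good \<open>a > 0\<close> zero_less_Suc[of g] unfolding good_def Suc_eq_plus1 by meson
    then show ?thesis
      by simp
  qed
qed

section \<open>Counting roots against exceptional points\<close>

definition roots :: "'a set" where
  "roots = {v. \<exists>i<4. poly (F i) v = 0}"

lemma finite_bad: "finite bad"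
proof -
  have "bad \<subseteq> (\<Union>i\<in>{..<4}. \<Union>j\<in>{..<4} - {i}. {v. poly (wronskian (F i) (F j)) v = 0})"
  proof
    fix v assume "v \<in> bad"
    then obtain i j where ij: "i < 4" "j < 4" "i \<noteq> j" "eps i j v \<ge> 480"
      by (auto simp: bad_def)
    then have "order v (wronskian (F i) (F j)) \<noteq> 0"
      by (auto simp: eps_def)
    then have "poly (wronskian (F i) (F j)) v = 0"
      using order_root by blast
    then show "v \<in> (\<Union>i\<in>{..<4}. \<Union>j\<in>{..<4} - {i}. {v. poly (wronskian (F i) (F j)) v = 0})"
      using ij by blast
  qed
  moreover have "finite (\<Union>i\<in>{..<4}. \<Union>j\<in>{..<4} - {i}. {v. poly (wronskian (F i) (F j)) v = 0})"
    using wronskian_nz poly_roots_finite by auto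
  ultimately show ?thesis
    by (rule finite_subset)
qed

lemma finite_roots: "finite roots"
proof -
  have "roots = (\<Union>i\<in>{..<4}. {v. poly (F i) v = 0})"
    by (auto simp: roots_def)
  then show ?thesis
    using nz poly_roots_finite by auto
qed

text \<open>Outside \<open>bad\<close>, the roots of \<open>a * b * c\<close> are those of
  \<open>F j\<close>, \<open>F k\<close>, \<open>F m\<close>, with multiplicity at least 481, that
  is 478 + 3.\<close>

lemma card_roots_le:
  assumes d: "distinct4 l j k m"
  shows "478 * card {v \<in> roots - bad. poly (F l) v \<noteq> 0} \<le> 3 * card bad"
proof -
  note d' = distinct4D[OF d]
  have perms: "distinct4 l k j m" "distinct4 l m j k"
    using d unfolding distinct4_def by auto
  obtain G a b c s where s: "s > 0" and G: "G \<noteq> 0"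
    and W: "W l j = G * a ^ (p ^ s)" "W l k = G * b ^ (p ^ s)" "W l m = G * c ^ (p ^ s)"
    and nz': "a \<noteq> 0" "b \<noteq> 0" "c \<noteq> 0" and sum: "a + b + c = 0"
    and cop: "\<And>v. poly a v \<noteq> 0 \<or> poly b v \<noteq> 0"
    and deg: "degree (a * b * c) \<le> 3 * card {v. poly (a * b * c) v = 0}"
    using frobenius_mason[of "W l j" "W l k" "W l m"] W_nz d' W_sum[OF d] wronskian_W[OF d] prime CHAR
    by metis
  have ord: "order v (W l j) = order v G + p ^ s * order v a"
    "order v (W l k) = order v G + p ^ s * order v b"
    "order v (W l m) = order v G + p ^ s * order v c" for v
    using G nz' unfolding W by (simp_all add: order_mult order_power_eq)
  have two: "order v a = 0 \<and> order v b = 0 \<or> order v b = 0 \<and> order v c = 0 \<or> order v a = 0 \<and> order v c = 0" for v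
  proof -
    have "poly a v + poly b v + poly c v = 0"
      using arg_cong[OF sum, of "\<lambda>f. poly f v"] by simp
    then show ?thesis
      using cop[of v] by (metis add_0 add_0_right order_0I)
  qed
  \<comment> \<open>\<open>row_root\<close> treats the first entry of a row, so \<open>two\<close>
    is also needed for the reordered rows.\<close>
  have two': "order v b = 0 \<and> order v a = 0 \<or> order v a = 0 \<and> order v c = 0 \<or> order v b = 0 \<and> order v c = 0"
    "order v c = 0 \<and> order v a = 0 \<or> order v a = 0 \<and> order v b = 0 \<or> order v c = 0 \<and> order v b = 0" for v
    using two[of v] by auto
  have ord_abc: "order v (a * b * c) = order v a + order v b + order v c" for v
    using nz' by (simp add: order_mult)
  have big: "481 \<le> order v (a * b * c)"
    if v: "v \<notin> bad" and "poly (F j) v = 0 \<or> poly (F k) v = 0 \<or> poly (F m) v = 0" for v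
    using that(2)
  proof (elim disjE)
    assume "poly (F j) v = 0"
    then show ?thesis
      using row_root(1)[OF v d s ord two] by (simp add: ord_abc)
  next
    assume "poly (F k) v = 0"
    then show ?thesis
      using row_root(1)[OF v perms(1) s ord(2,1,3) two'(1)] by (simp add: ord_abc)
  next
    assume "poly (F m) v = 0"
    then show ?thesis
      using row_root(1)[OF v perms(2) s ord(3,1,2) two'(2)] by (simp add: ord_abc)
  qed
  have small: "order v (a * b * c) = 0"
    if "v \<notin> bad" "\<not> (poly (F j) v = 0 \<or> poly (F k) v = 0 \<or> poly (F m) v = 0)" for v
    using row_no_root[OF that(1) d s ord two] that(2) by (simp add: ord_abc)
  have abc0: "a * b * c \<noteq> 0"
    using nz' by simp
  show ?thesis
  proof (rule card_high_multiplicity_roots_le[OF abc0 deg finite_bad])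
    fix v assume v: "v \<notin> bad" "poly (a * b * c) v = 0"
    then have "order v (a * b * c) \<noteq> 0"
      using abc0 order_root by blast
    then show "478 + 3 \<le> order v (a * b * c)"
      using big[OF v(1)] small[OF v(1)] by fastforce
  next
    fix v assume v: "v \<in> {v \<in> roots - bad. poly (F l) v \<noteq> 0}"
    then obtain i where "i < 4" "poly (F i) v = 0"
      by (auto simp: roots_def)
    moreover from this v have "i \<noteq> l"
      by auto
    ultimately have "poly (F j) v = 0 \<or> poly (F k) v = 0 \<or> poly (F m) v = 0"
      using d unfolding distinct4_def by (metis insertE lessThan_iff singletonD)
    then show "v \<notin> bad \<and> poly (a * b * c) v = 0"
      using big[of v] v by (metis (no_types, lifting) DiffD2 mem_Collect_eq not_numeral_le_zero order_0I)
  qed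
qed

lemma sum_eps_neg:
  assumes "i < 4" "j < 4" "i \<noteq> j" "finite P" "roots \<subseteq> P" "{v. poly (wronskian (F i) (F j)) v = 0} \<subseteq> P"
  shows "(\<Sum>v\<in>P. eps i j v) \<le> -1"
proof -
  have "degree (wronskian (F i) (F j)) = (\<Sum>v\<in>P. order v (wronskian (F i) (F j)))"
    using assms(6) by (intro degree_eq_sum_order wronskian_nz assms) blast
  moreover have "degree (F i) = (\<Sum>v\<in>P. order v (F i))" "degree (F j) = (\<Sum>v\<in>P. order v (F j))"
    using assms(1,2,5) by (intro degree_eq_sum_order nz assms; force simp: roots_def)+
  ultimately have "(\<Sum>v\<in>P. eps i j v) =
      int (degree (wronskian (F i) (F j))) - int (degree (F i)) - int (degree (F j))"
    by (simp only: eps_def sum_subtractf of_nat_sum)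
  then show ?thesis
    using degree_wronskian_less[OF wronskian_nz[OF assms(1-3)]] by linarith
qed

text \<open>The six values \<open>eps\<close> have negative total. At a bad point one is at least
  480 and the others at least -1, which gives 475; at other roots their sum is at least -6, and
  elsewhere at least 0.\<close>

lemma card_bad_less: "475 * card bad < 6 * card roots"
proof -
  define P where "P = roots \<union> bad \<union>
    (\<Union>i\<in>{..<4}. \<Union>j\<in>{..<4} - {i}. {v. poly (wronskian (F i) (F j)) v = 0})"
  have finP: "finite P"
    using finite_bad finite_roots wronskian_nz poly_roots_finite unfolding P_def by auto
  define E where "E v = eps 0 1 v + eps 0 2 v + eps 0 3 v + eps 1 2 v + eps 1 3 v + eps 2 3 v" for v
  have neg: "(\<Sum>v\<in>P. eps i j v) \<le> -1" if "i < 4" "j < 4" "i \<noteq> j" for i j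
    using that finP by (intro sum_eps_neg) (auto simp: P_def)
  have "(\<Sum>v\<in>P. E v) \<le> -6"
    using neg[of 0 1] neg[of 0 2] neg[of 0 3] neg[of 1 2] neg[of 1 3] neg[of 2 3]
    unfolding E_def sum.distrib by simp
  moreover have "475 * (if v \<in> bad then 1 else 0) - 6 * (if v \<in> roots then 1 else 0) \<le> E v" for v
  proof -
    define t :: int where "t = (if v \<in> roots then -1 else 0)"
    have ge: "t \<le> eps i j v" if "i < 4" "j < 4" "i \<noteq> j" for i j
    proof (cases "v \<in> roots")
      case False
      then have "order v (F i) = 0" "order v (F j) = 0"
        using that by (auto simp: roots_def intro!: order_0I)
      then show ?thesis
        using False by (simp add: eps_def t_def)
    qed (use eps_ge[OF that] in \<open>simp add: t_def\<close>)
    define e where "e = (if v \<in> bad then 480 else t)"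
    have ge': "t \<le> eps 0 1 v" "t \<le> eps 0 2 v" "t \<le> eps 0 3 v" "t \<le> eps 1 2 v" "t \<le> eps 1 3 v" "t \<le> eps 2 3 v"
      by (simp_all add: ge)
    have ex: "e \<le> eps 0 1 v \<or> e \<le> eps 0 2 v \<or> e \<le> eps 0 3 v \<or>
        e \<le> eps 1 2 v \<or> e \<le> eps 1 3 v \<or> e \<le> eps 2 3 v"
    proof (cases "v \<in> bad")
      case True
      then obtain i j where ij: "i < 4" "j < 4" "i \<noteq> j" "e \<le> eps i j v"
        unfolding bad_def e_def by auto
      then have "i \<in> {0, 1, 2, 3}" "j \<in> {0, 1, 2, 3}"
        by auto
      then show ?thesis
        using ij(3,4) eps_commute[of 1 0 v] eps_commute[of 2 0 v] eps_commute[of 3 0 v]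
          eps_commute[of 2 1 v] eps_commute[of 3 1 v] eps_commute[of 3 2 v]
        by (elim insertE emptyE) (simp_all only: not_False_eq_True simp_thms)
    next
      case False
      then show ?thesis
        using ge'(1) by (simp add: e_def)
    qed
    have "e + 5 * t \<le> E v"
      using ex unfolding E_def by (elim disjE) (use ge' in linarith)+
    moreover have "475 * (if v \<in> bad then 1 else 0) - 6 * (if v \<in> roots then 1 else 0) \<le> e + 5 * t"
      by (simp add: e_def t_def)
    ultimately show ?thesis
      by linarith
  qed
  then have "(\<Sum>v\<in>P. 475 * (if v \<in> bad then 1 else 0) - 6 * (if v \<in> roots then 1 else 0)) \<le> (\<Sum>v\<in>P. E v)"
    by (intro sum_mono)
  moreover have "(\<Sum>v\<in>P. 475 * (if v \<in> bad then 1 else 0) - 6 * (if v \<in> roots then 1 else 0)) =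
      475 * int (card bad) - 6 * int (card roots)"
  proof -
    have ind: "(\<Sum>v\<in>P. if v \<in> A then 1 else 0) = int (card A)" if "A \<subseteq> P" for A
      using finP that by (simp add: sum.inter_restrict[symmetric] Int_absorb1)
    have "bad \<subseteq> P" "roots \<subseteq> P"
      by (auto simp: P_def)
    then show ?thesis
      by (simp only: sum_subtractf sum_distrib_left[symmetric] ind)
  qed
  ultimately show ?thesis
    by linarith
qed

text \<open>Off \<open>bad\<close>, \<open>F 0\<close> and \<open>F 1\<close> have no common root,
  so two rows cover all roots: their number is at most \<open>1 + 6/478\<close> times that of the
  bad points, yet exceeds \<open>475/6\<close> times it.\<close>

theorem contradiction: False
proof -
  have d: "distinct4 0 1 2 3" "distinct4 1 0 2 3"
    unfolding distinct4_def by auto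
  let ?T = "\<lambda>l. {v \<in> roots - bad. poly (F l) v \<noteq> 0}"
  have "roots \<subseteq> bad \<union> ?T 0 \<union> ?T 1"
    using not_bad_one_root[OF _ d(1)] by auto
  moreover have fin: "finite (?T l)" for l
    using finite_roots by simp
  ultimately have "card roots \<le> card (bad \<union> ?T 0 \<union> ?T 1)"
    using finite_bad by (intro card_mono) auto
  also have "\<dots> \<le> card bad + card (?T 0) + card (?T 1)"
    by (meson add_le_mono1 card_Un_le le_trans)
  finally show False
    using card_roots_le[OF d(1)] card_roots_le[OF d(2)] card_bad_less by linarith
qed

end

subsection \<open>Descent to the rational function field\<close>

lemma pcompose_monom_monom:
  "pcompose (monom c i) (monom 1 n) = monom (c :: 'a::comm_semiring_1) (n * i)"
proof (induction i)
  case (Suc i)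
  then show ?case
    by (simp add: monom_Suc pcompose_pCons mult_monom)
qed (simp add: monom_0)

text \<open>Over a field that may lack \<open>p\<close>-th roots the result is a polynomial in the
  \<open>p\<close>-th power of the variable: coefficients at exponents prime to the characteristic
  vanish.\<close>

lemma pderiv_eq_0_imp_pcompose_monom:
  fixes f :: "'a::field poly"
  assumes "prime CHAR('a)" "pderiv f = 0"
  shows "\<exists>g. f = pcompose g (monom 1 CHAR('a))"
proof
  let ?p = "CHAR('a)"
  have p0: "?p > 0"
    using assms(1) prime_gt_0_nat by blast
  \<comment> \<open>The bound \<open>degree f\<close> is generous: larger \<open>i\<close> would
    only contribute zero coefficients.\<close>
  define g where "g = (\<Sum>i\<le>degree f. monom (coeff f (?p * i)) i)"
  have coeff_g: "coeff (pcompose g (monom 1 ?p)) n =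
      (\<Sum>i\<le>degree f. if ?p * i = n then coeff f (?p * i) else 0)" for n
    by (simp add: g_def pcompose_sum pcompose_monom_monom coeff_sum)
  show "f = pcompose g (monom 1 ?p)"
  proof (rule poly_eqI)
    fix n
    show "coeff f n = coeff (pcompose g (monom 1 ?p)) n"
    proof (cases "?p dvd n")
      case True
      then obtain k where k: "n = ?p * k"
        by (elim dvdE)
      have "coeff (pcompose g (monom 1 ?p)) n = (\<Sum>i\<le>degree f. if i = k then coeff f n else 0)"
        unfolding coeff_g using p0 by (intro sum.cong) (auto simp: k)
      also have "\<dots> = (if k \<le> degree f then coeff f n else 0)"
        by simp
      also have "\<dots> = coeff f n"
      proof -
        have "k \<le> n"
          using p0 by (simp add: k)
        then show ?thesis
          by (auto intro: coeff_eq_0)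
      qed
      finally show ?thesis
        by simp
    next
      case False
      then obtain m where m: "n = Suc m"
        by (cases n) auto
      have "of_nat n * coeff f n = 0"
        using arg_cong[OF assms(2), of "\<lambda>q. coeff q m"] by (simp add: coeff_pderiv m)
      moreover have "of_nat n \<noteq> (0 :: 'a)"
        using False by (simp add: of_nat_eq_0_iff_char_dvd)
      ultimately have "coeff f n = 0"
        by simp
      moreover have "coeff (pcompose g (monom 1 ?p)) n = 0"
        unfolding coeff_g using False by (intro sum.neutral) auto
      ultimately show ?thesis
        by simp
    qed
  qed
qed

text \<open>
  Expanding \<open>f / g\<close> to \<open>f g\<^sup>p\<^sup>-\<^sup>1 / g\<^sup>p\<close> gives numerator and denominator zero derivative, without
  reducing the fraction to lowest terms.
\<close>
lemma Fract_in_ratfun_power_subfield: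
  fixes f g :: "'a::field poly"
  assumes "prime CHAR('a)" "wronskian f g = 0" "g \<noteq> 0"
  shows "Fraction_Field.Fract f g \<in> ratfun_power_subfield CHAR('a)"
proof -
  have p2: "CHAR('a) \<ge> 2"
    using assms(1) prime_ge_2_nat by blast
  define r where "r = CHAR('a) - 2"
  have r: "CHAR('a) = Suc (Suc r)"
    using p2 by (simp add: r_def)
  have "of_nat (Suc (Suc r)) = (0 :: 'a)"
    using r by (metis of_nat_CHAR)
  then have minus1: "of_nat (Suc r) = (-1 :: 'a)"
    by (simp add: eq_neg_iff_add_eq_0 add.commute)
  have "pderiv (g ^ Suc (Suc r)) = 0"
    unfolding pderiv_power_Suc using \<open>of_nat (Suc (Suc r)) = 0\<close> by simp
  then obtain g1 where g1: "g ^ Suc (Suc r) = pcompose g1 (monom 1 CHAR('a))"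
    using pderiv_eq_0_imp_pcompose_monom[OF assms(1)] by blast
  \<comment> \<open>\<open>Suc r\<close> is -1 in the field, which turns the product rule into a
    Wronskian.\<close>
  have "pderiv (f * g ^ Suc r) = - (g ^ r * wronskian f g)"
    unfolding pderiv_mult pderiv_power_Suc minus1 wronskian_def by (simp add: algebra_simps)
  then have "pderiv (f * g ^ Suc r) = 0"
    using assms(2) by simp
  then obtain f1 where f1: "f * g ^ Suc r = pcompose f1 (monom 1 CHAR('a))"
    using pderiv_eq_0_imp_pcompose_monom[OF assms(1)] by blast
  have "g1 \<noteq> 0"
    using g1 assms(3) by (metis pcompose_0 power_not_zero)
  have "Fraction_Field.Fract f g = Fraction_Field.Fract (g ^ Suc r * f) (g ^ Suc r * g)"
    using assms(3) by (intro mult_fract_cancel[symmetric]) simp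
  also have "\<dots> = Fraction_Field.Fract (pcompose f1 (monom 1 CHAR('a))) (pcompose g1 (monom 1 CHAR('a)))"
    unfolding f1[symmetric] g1[symmetric] by (simp add: mult_ac)
  finally show ?thesis
    using \<open>g1 \<noteq> 0\<close> unfolding ratfun_power_subfield_def by blast
qed

section \<open>Embedding into the algebraic closure\<close>

interpretation to_ac: inj_idom_hom "to_ac :: 'a::field \<Rightarrow> 'a alg_closure"
  by unfold_locales auto

interpretation to_ac_poly: map_poly_inj_idom_hom "to_ac :: 'a::field \<Rightarrow> 'a alg_closure" ..

lemma wronskian_map_poly_to_ac:
  "wronskian (map_poly to_ac f) (map_poly to_ac g) = map_poly to_ac (wronskian f g)"
  by (simp add: wronskian_def to_ac.map_poly_pderiv[symmetric] to_ac_poly.hom_mult to_ac_poly.hom_minus)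

text \<open>The closure supplies an \<open>N\<close>-th root of -1 that moves \<open>F 3\<close>
  across the equation. Embedding, scaling and removal of the common factor keep the Wronskians
  nonzero.\<close>

lemma fermat_no_solution:
  fixes F :: "nat \<Rightarrow> 'a::field poly"
  assumes "CHAR('a) = p" "prime p" "p > 480" "coprime N p" "good 480 p N"
    and sum: "F 0 ^ N + F 1 ^ N + F 2 ^ N = F 3 ^ N"
    and wr: "\<And>i j. i < 4 \<Longrightarrow> j < 4 \<Longrightarrow> i \<noteq> j \<Longrightarrow> wronskian (F i) (F j) \<noteq> 0"
  shows False
proof -
  have N0: "N > 0"
    using assms(5) by (simp add: good_def)
  obtain z :: "'a alg_closure" where z: "z ^ N = -1"
    using nth_root_exists[OF N0] by blast
  then have z0: "z \<noteq> 0"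
    using N0 by (auto simp: power_0_left)
  define c where "c = (\<lambda>i::nat. if i = 3 then z else 1)"
  define Q where "Q i = smult (c i) (map_poly to_ac (F i))" for i
  have "F 0 \<noteq> 0"
    using wr[of 0 1] by (auto simp: wronskian_def)
  then have "Q 0 \<noteq> 0"
    by (simp add: Q_def c_def)
  then obtain G Y where G: "G \<noteq> 0" and QY: "\<forall>i<4. Q i = G * Y i"
    and Y: "\<forall>v. \<exists>i<4. poly (Y i) v \<noteq> 0"
    using divide_out_common_roots[of 4 Q] by auto
  have wrQ: "wronskian (Q i) (Q j) = smult (c i * c j) (map_poly to_ac (wronskian (F i) (F j)))" for i j
    unfolding wronskian_map_poly_to_ac[symmetric] Q_def
    by (simp add: wronskian_def pderiv_smult smult_diff_right mult.commute[of "c j"])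
  have "Q 0 ^ N + Q 1 ^ N + Q 2 ^ N + Q 3 ^ N =
      map_poly to_ac (F 0 ^ N + F 1 ^ N + F 2 ^ N - F 3 ^ N)"
    by (simp add: Q_def c_def smult_power z to_ac_poly.hom_power to_ac_poly.hom_add to_ac_poly.hom_minus)
  then have "Q 0 ^ N + Q 1 ^ N + Q 2 ^ N + Q 3 ^ N = 0"
    using sum by simp
  then have "(\<Sum>i<4. Q i ^ N) = 0"
    by (simp add: eval_nat_numeral)
  moreover have "(\<Sum>i<4. Q i ^ N) = G ^ N * (\<Sum>i<4. Y i ^ N)"
    unfolding sum_distrib_left using QY by (intro sum.cong) (auto simp: power_mult_distrib)
  ultimately have sumY: "(\<Sum>i<4. Y i ^ N) = 0"
    using G by simp
  have wrY: "wronskian (Y i) (Y j) \<noteq> 0" if "i < 4" "j < 4" "i \<noteq> j" for i j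
  proof
    assume "wronskian (Y i) (Y j) = 0"
    then have "wronskian (Q i) (Q j) = 0"
      using QY that(1,2) by (simp add: wronskian_mult_left)
    moreover have "c i * c j \<noteq> 0"
      using z0 by (simp add: c_def)
    ultimately show False
      using wr[OF that] by (simp add: wrQ)
  qed
  interpret fermat_solution Y N p
    by unfold_locales (use assms sumY Y wrY in simp_all)
  show False
    by (rule contradiction)
qed

lemma Fract_power: "Fraction_Field.Fract a b ^ n = Fraction_Field.Fract (a ^ n) (b ^ n)"
  by (induction n) (simp_all add: One_fract_def)

theorem theorem1p3:
  fixes p N :: nat
  assumes "CARD('p::prime_card) = p"
    and "prime p" and "p > 480"
    and "N > 0" and "coprime N p"
    and "good 480 p N"
  shows "\<not> (\<exists>x y z :: 'p ratfun.
            x ^ N + y ^ N + z ^ N = 1 \<and>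
            x \<notin> ratfun_power_subfield p \<and>
            y \<notin> ratfun_power_subfield p \<and>
            z \<notin> ratfun_power_subfield p \<and>
            x / y \<notin> ratfun_power_subfield p \<and>
            x / z \<notin> ratfun_power_subfield p \<and>
            y / z \<notin> ratfun_power_subfield p)"
proof (intro notI, elim exE conjE)
  fix x y z :: "'p ratfun"
  assume eq: "x ^ N + y ^ N + z ^ N = 1"
    and nx: "x \<notin> ratfun_power_subfield p" and ny: "y \<notin> ratfun_power_subfield p"
    and nz: "z \<notin> ratfun_power_subfield p" and nxy: "x / y \<notin> ratfun_power_subfield p"
    and nxz: "x / z \<notin> ratfun_power_subfield p" and nyz: "y / z \<notin> ratfun_power_subfield p"
  have CHAR: "CHAR('p mod_ring) = p"
    using assms(1) by simp
  obtain a1 b1 where x: "x = Fraction_Field.Fract a1 b1" "b1 \<noteq> 0"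
    by (cases x rule: Fract_cases) auto
  obtain a2 b2 where y: "y = Fraction_Field.Fract a2 b2" "b2 \<noteq> 0"
    by (cases y rule: Fract_cases) auto
  obtain a3 b3 where z: "z = Fraction_Field.Fract a3 b3" "b3 \<noteq> 0"
    by (cases z rule: Fract_cases) auto
  \<comment> \<open>With the common denominator \<open>H\<close> as fourth polynomial,
    \<open>x\<close>, \<open>y\<close>, \<open>z\<close> are also quotients of two of the four, so
    all six conditions have one shape.\<close>
  define H Q Y Z where "H = b1 * b2 * b3" and "Q = a1 * b2 * b3" and "Y = b1 * a2 * b3"
    and "Z = b1 * b2 * a3"
  have H0: "H \<noteq> 0"
    using x y z by (simp add: H_def)
  have xX: "x = Fraction_Field.Fract Q H" and yY: "y = Fraction_Field.Fract Y H"
    and zZ: "z = Fraction_Field.Fract Z H"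
    using x y z by (simp_all add: eq_fract H_def Q_def Y_def Z_def)
  have wrH: "wronskian F H \<noteq> 0" if "Fraction_Field.Fract F H \<notin> ratfun_power_subfield p" for F
    using Fract_in_ratfun_power_subfield[of F H] that H0 assms(2) CHAR by auto
  then have wrXH: "wronskian Q H \<noteq> 0" and wrYH: "wronskian Y H \<noteq> 0" and wrZH: "wronskian Z H \<noteq> 0"
    using nx ny nz xX yY zZ by auto
  have wrFG: "wronskian F G \<noteq> 0"
    if "Fraction_Field.Fract F H / Fraction_Field.Fract G H \<notin> ratfun_power_subfield p"
      "wronskian G H \<noteq> 0" for F G
  proof -
    have "G \<noteq> 0"
      using that(2) by (auto simp: wronskian_def)
    then have "Fraction_Field.Fract F H / Fraction_Field.Fract G H = Fraction_Field.Fract F G"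
      using H0 by (simp add: eq_fract)
    then show ?thesis
      using Fract_in_ratfun_power_subfield[of F G] that(1) \<open>G \<noteq> 0\<close> assms(2) CHAR by auto
  qed
  have wrXY: "wronskian Q Y \<noteq> 0" and wrXZ: "wronskian Q Z \<noteq> 0" and wrYZ: "wronskian Y Z \<noteq> 0"
    using wrFG nxy nxz nyz wrYH wrZH xX yY zZ by auto
  \<comment> \<open>Adding three fractions by cross multiplication leaves this extra factor.\<close>
  have "(H ^ N * H ^ N) * (Q ^ N + Y ^ N + Z ^ N) = (H ^ N * H ^ N) * H ^ N"
    using eq H0 unfolding xX yY zZ Fract_power
    by (simp add: eq_fract One_fract_def algebra_simps)
  then have sum: "Q ^ N + Y ^ N + Z ^ N = H ^ N"
    unfolding mult_cancel_left using H0 by simp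
  define F where "F = (\<lambda>i::nat. if i = 0 then Q else if i = 1 then Y else if i = 2 then Z else H)"
  have "wronskian (F i) (F j) \<noteq> 0" if "i < 4" "j < 4" "i \<noteq> j" for i j
  proof -
    have less: "wronskian (F i) (F j) \<noteq> 0" if "i < j" "j < 4" for i j
    proof -
      have "(i, j) \<in> {(0, 1), (0, 2), (0, 3), (1, 2), (1, 3), (2, 3)}"
        using that by (auto simp: less_Suc_eq numeral_eq_Suc)
      then show ?thesis
        using wrXH wrYH wrZH wrXY wrXZ wrYZ by (auto simp: F_def)
    qed
    show ?thesis
      using less[of i j] less[of j i] that wronskian_swap[of "F i" "F j"] by (cases "i < j") auto
  qed
  then show False
    using sum by (intro fermat_no_solution[OF CHAR assms(2,3,5,6), of F]) (auto simp: F_def)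
qed

end
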